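(* The schedule $\mathcal H^1=\{\{1\},\{2\},\dots,\{N\}\}$, in which each singleton group $\{i\}$ is activated for duration $d_i/r_{ii}$, is an optimal schedule if and only if $$\sum_{i\in \mathcal c}\frac{r_{i\mathcal c}}{r_{ii}}\le 1\qquad\text{for all } \mathcal c\in\mathcal H .$$
   Context: $\mathcal N=\{1,\dots,N\}$ is a set of links, with strictly positive demands $d_1,\dots,d_N$. $\mathcal H$ is the set of all nonempty subsets of $\mathcal N$, called groups. For each group $\mathcal c$ and link $i$, $r_{i\mathcal c}\ge 0$ is the service rate of link $i$ when $\mathcal c$ is active, with $r_{i\mathcal c}=0$ for $i\notin \mathcal c$; $r_{ii}$ denotes $r_{i,\{i\}}$, and $r_{ii}>0$. Rate monotonicity holds: if $\mathcal c_1\subset \mathcal c_2$ and $i\in \mathcal c_1$, then $r_{i\mathcal c_1}\ge r_{i\mathcal c_2}$. A schedule is a vector $T=(T_{\mathcal c})_{\mathcal c\in\mathcal H}\ge 0$ with $\sum_{\mathcal c\in\mathcal H}r_{i\mathcal c}T_{\mathcal c}=d_i$ for every $i$; its length is $\sum_{\mathcal c}T_{\mathcal c}$; it is optimal if its length is minimum. *)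

theory Defs
  imports Complex_Main
begin

definition links :: "nat \<Rightarrow> nat set" where
  "links N = {1..N}"

definition groups :: "nat \<Rightarrow> nat set set" where
  "groups N = {c. c \<subseteq> links N \<and> c \<noteq> {}}"

text \<open>A vector indexed by the groups is a function on sets of links; every notion below
  inspects it on \<^term>\<open>groups N\<close> only. The rate of link \<open>i\<close> in group \<open>c\<close> is \<open>r i c\<close>.\<close>

definition is_schedule ::
  "nat \<Rightarrow> (nat \<Rightarrow> real) \<Rightarrow> (nat \<Rightarrow> nat set \<Rightarrow> real) \<Rightarrow> (nat set \<Rightarrow> real) \<Rightarrow> bool" where
  "is_schedule N d r T \<longleftrightarrow>
     (\<forall>c\<in>groups N. T c \<ge> 0) \<and> (\<forall>i\<in>links N. (\<Sum>c\<in>groups N. r i c * T c) = d i)"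

definition schedule_length :: "nat \<Rightarrow> (nat set \<Rightarrow> real) \<Rightarrow> real" where
  "schedule_length N T = (\<Sum>c\<in>groups N. T c)"

definition optimal_schedule ::
  "nat \<Rightarrow> (nat \<Rightarrow> real) \<Rightarrow> (nat \<Rightarrow> nat set \<Rightarrow> real) \<Rightarrow> (nat set \<Rightarrow> real) \<Rightarrow> bool" where
  "optimal_schedule N d r T \<longleftrightarrow>
     is_schedule N d r T \<and>
     (\<forall>T'. is_schedule N d r T' \<longrightarrow> schedule_length N T \<le> schedule_length N T')"

definition singleton_schedule ::
  "(nat \<Rightarrow> real) \<Rightarrow> (nat \<Rightarrow> nat set \<Rightarrow> real) \<Rightarrow> nat set \<Rightarrow> real" where
  "singleton_schedule d r c =
     (if is_singleton c then d (the_elem c) / r (the_elem c) c else 0)"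

end

theory Submission
  imports Defs
begin

text \<open>Dual prices \<open>1 / r i {i}\<close> make every singleton tight, so the criterion is complementary
  slackness. Weighting the demand equations with these prices gives
  \<open>(\<Sum>i. d i / r i {i}) = (\<Sum>c. T c * w c)\<close> for every schedule \<open>T\<close>, where
  \<open>w c = (\<Sum>i\<in>c. r i c / r i {i})\<close>; if all \<open>w c \<le> 1\<close>, the left-hand side, which is the length of
  the singleton schedule, is minimal. If \<open>w c > 1\<close>, activating \<open>c\<close> for a short duration \<open>e\<close> and
  serving the residual demands by singletons changes the length by \<open>e * (1 - w c) < 0\<close>.\<close>

lemma finite_links [simp]: "finite (links N)"
  by (simp add: links_def)

lemma finite_groups [simp]: "finite (groups N)"
  by (simp add: groups_def)

lemma singleton_in_groups [simp]: "{i} \<in> groups N \<longleftrightarrow> i \<in> links N"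
  by (auto simp: groups_def)

text \<open>The singletons in \<open>groups N\<close> form the injective image of
  \<open>links N\<close> under \<open>\<lambda>i. {i}\<close>; all other terms vanish.\<close>

lemma sum_groups_only_singletons:
  fixes f :: "nat set \<Rightarrow> real"
  assumes "\<And>c. c \<in> groups N \<Longrightarrow> \<not> is_singleton c \<Longrightarrow> f c = 0"
  shows "sum f (groups N) = (\<Sum>i\<in>links N. f {i})"
proof -
  have "is_singleton c \<longleftrightarrow> c \<in> (\<lambda>i. {i}) ` links N" if "c \<in> groups N" for c
    using that by (auto simp: is_singleton_def)
  then have "sum f (groups N) = sum f ((\<lambda>i. {i}) ` links N)"
    using assms by (intro sum.mono_neutral_right) auto
  also have "\<dots> = (\<Sum>i\<in>links N. f {i})"
    by (subst sum.reindex) auto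
  finally show ?thesis .
qed

lemma singleton_schedule_singleton [simp]: "singleton_schedule d r {i} = d i / r i {i}"
  by (simp add: singleton_schedule_def)

lemma length_singleton_schedule:
  "schedule_length N (singleton_schedule d r) = (\<Sum>i\<in>links N. d i / r i {i})"
  unfolding schedule_length_def
  by (subst sum_groups_only_singletons) (auto simp: singleton_schedule_def)

text \<open>Demands may be zero here, since the lemma also serves residual demands, some of which
  may be used up.\<close>

lemma is_schedule_singleton_schedule:
  assumes demand_nonneg: "\<And>i. i \<in> links N \<Longrightarrow> d i \<ge> 0"
    and rate_inactive: "\<And>i c. i \<in> links N \<Longrightarrow> c \<in> groups N \<Longrightarrow> i \<notin> c \<Longrightarrow> r i c = 0"
    and rate_single_pos: "\<And>i. i \<in> links N \<Longrightarrow> r i {i} > 0"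
  shows "is_schedule N d r (singleton_schedule d r)"
  unfolding is_schedule_def
proof (intro conjI ballI)
  fix c assume "c \<in> groups N"
  then show "singleton_schedule d r c \<ge> 0"
    using demand_nonneg rate_single_pos
    by (auto simp: singleton_schedule_def is_singleton_def intro!: divide_nonneg_pos)
next
  fix i assume i: "i \<in> links N"
  have "(\<Sum>c\<in>groups N. r i c * singleton_schedule d r c)
      = (\<Sum>j\<in>links N. r i {j} * singleton_schedule d r {j})"
    by (rule sum_groups_only_singletons) (simp add: singleton_schedule_def)
  also have "\<dots> = (\<Sum>j\<in>links N. if j = i then d i else 0)"
    using i rate_inactive[OF i] rate_single_pos[OF i] by (intro sum.cong) auto
  also have "\<dots> = d i"
    using i by simp
  finally show "(\<Sum>c\<in>groups N. r i c * singleton_schedule d r c) = d i" .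
qed

text \<open>As \<open>S c = 0\<close>, overwriting the entry at \<open>c\<close> by \<open>e\<close>
  amounts to adding \<open>e\<close>, which restores the demand \<open>r i c * e\<close> removed
  beforehand.\<close>

lemma is_schedule_activate:
  assumes S: "is_schedule N (\<lambda>i. d i - r i c * e) r S"
    and c: "c \<in> groups N" "S c = 0" and e: "e \<ge> 0"
  shows "is_schedule N d r (S(c := e))"
    and "schedule_length N (S(c := e)) = schedule_length N S + e"
proof -
  \<comment> \<open>The weight \<open>f\<close> covers both claims: \<open>r i\<close> gives the
    demand equations, the constant 1 the length.\<close>
  have add: "(\<Sum>b\<in>groups N. f b * (S(c := e)) b) = (\<Sum>b\<in>groups N. f b * S b) + f c * e"
    for f :: "nat set \<Rightarrow> real"
    using c by (simp add: sum.remove[of "groups N" c])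
  show "is_schedule N d r (S(c := e))"
    using S e unfolding is_schedule_def add by simp
  show "schedule_length N (S(c := e)) = schedule_length N S + e"
    using add[of "\<lambda>_. 1"] by (simp add: schedule_length_def)
qed

text \<open>Weight the demand equation of each link \<open>i\<close> by a price \<open>p i\<close>
  and exchange the two sums.\<close>

lemma sum_weighted_demands:
  assumes T: "is_schedule N d r T"
  shows "(\<Sum>i\<in>links N. p i * d i) = (\<Sum>c\<in>groups N. (\<Sum>i\<in>links N. p i * r i c) * T c)"
proof -
  have "(\<Sum>i\<in>links N. p i * d i) = (\<Sum>i\<in>links N. \<Sum>c\<in>groups N. p i * r i c * T c)"
    using T by (intro sum.cong) (auto simp: is_schedule_def mult.assoc simp flip: sum_distrib_left)
  also have "\<dots> = (\<Sum>c\<in>groups N. (\<Sum>i\<in>links N. p i * r i c) * T c)"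
    by (subst sum.swap) (simp add: sum_distrib_right)
  finally show ?thesis .
qed

theorem theorem4:
  fixes N :: nat and d :: "nat \<Rightarrow> real" and r :: "nat \<Rightarrow> nat set \<Rightarrow> real"
  assumes demand_pos: "\<And>i. i \<in> links N \<Longrightarrow> d i > 0"
    and rate_nonneg: "\<And>i c. i \<in> links N \<Longrightarrow> c \<in> groups N \<Longrightarrow> r i c \<ge> 0"
    and rate_inactive: "\<And>i c. i \<in> links N \<Longrightarrow> c \<in> groups N \<Longrightarrow> i \<notin> c \<Longrightarrow> r i c = 0"
    and rate_single_pos: "\<And>i. i \<in> links N \<Longrightarrow> r i {i} > 0"
    and rate_mono: "\<And>i c1 c2. c1 \<in> groups N \<Longrightarrow> c2 \<in> groups N \<Longrightarrow> c1 \<subset> c2 \<Longrightarrow> i \<in> c1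
                      \<Longrightarrow> r i c1 \<ge> r i c2"
  shows "optimal_schedule N d r (singleton_schedule d r) \<longleftrightarrow>
           (\<forall>c\<in>groups N. (\<Sum>i\<in>c. r i c / r i {i}) \<le> 1)"
proof -
  let ?S = "singleton_schedule d r"
  let ?w = "\<lambda>c. \<Sum>i\<in>c. r i c / r i {i}"
  have S: "is_schedule N d r ?S"
    using demand_pos rate_inactive rate_single_pos
    by (intro is_schedule_singleton_schedule) (auto intro: less_imp_le)
  \<comment> \<open>Links outside \<open>c\<close> have rate 0 in \<open>c\<close>, so the sum may
    range over all links, as the exchange of sums requires.\<close>
  have w_links: "?w c = (\<Sum>i\<in>links N. r i c / r i {i})" if "c \<in> groups N" for c
    using that rate_inactive by (intro sum.mono_neutral_left) (auto simp: groups_def)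
  show ?thesis
  proof
    assume opt: "optimal_schedule N d r ?S"
    show "\<forall>c\<in>groups N. ?w c \<le> 1"
    proof (intro ballI leI notI)
      fix c assume c: "c \<in> groups N" and w: "?w c > 1"
      \<comment> \<open>For \<open>c = {i}\<close> the sum is \<open>r i {i} / r i {i}\<close>,
        which never exceeds 1.\<close>
      have not_single: "\<not> is_singleton c"
        using w by (auto elim!: is_singletonE split: if_splits)
      \<comment> \<open>\<open>e\<close> must be positive with \<open>r i c * e \<le> d i\<close>
        for every link; the added 1 keeps the denominator positive when
        \<open>r i c = 0\<close>.\<close>
      define e where "e = Min ((\<lambda>i. d i / (1 + r i c)) ` links N)"
      have ne: "links N \<noteq> {}"
        using c by (auto simp: groups_def)
      have e_pos: "e > 0"
        using ne demand_pos rate_nonneg[OF _ c] by (auto simp: e_def add_pos_nonneg)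
      have residual: "d i - r i c * e \<ge> 0" if i: "i \<in> links N" for i
      proof -
        have "e \<le> d i / (1 + r i c)"
          using i by (simp add: e_def)
        then have "e * (1 + r i c) \<le> d i"
          using rate_nonneg[OF i c] by (simp add: pos_le_divide_eq)
        then show ?thesis
          using e_pos by (simp add: algebra_simps)
      qed
      let ?R = "singleton_schedule (\<lambda>i. d i - r i c * e) r"
      have R: "is_schedule N (\<lambda>i. d i - r i c * e) r ?R"
        using residual rate_inactive rate_single_pos by (rule is_schedule_singleton_schedule)
      have R_c: "?R c = 0"
        using not_single by (simp add: singleton_schedule_def)
      note T = is_schedule_activate[OF R c R_c less_imp_le[OF e_pos]]
      have "schedule_length N ?S \<le> schedule_length N (?R(c := e))"
        using opt T(1) by (auto simp: optimal_schedule_def)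
      also have "\<dots> = schedule_length N ?R + e"
        by (rule T(2))
      also have "\<dots> = schedule_length N ?S - ?w c * e + e"
        unfolding length_singleton_schedule w_links[OF c]
        by (simp add: diff_divide_distrib sum_subtractf sum_distrib_right)
      finally have "?w c * e \<le> 1 * e"
        by simp
      then show False
        using w e_pos by (simp only: mult_le_cancel_right_pos)
    qed
  next
    assume w: "\<forall>c\<in>groups N. ?w c \<le> 1"
    have "schedule_length N ?S \<le> schedule_length N T" if T: "is_schedule N d r T" for T
    proof -
      \<comment> \<open>With the prices \<open>1 / r i {i}\<close>, the weighted total demand is the
        length of \<open>?S\<close>, and the coefficient of \<open>T c\<close> is
        \<open>?w c\<close>.\<close>
      have "schedule_length N ?S = (\<Sum>c\<in>groups N. ?w c * T c)"
        using sum_weighted_demands[OF T, of "\<lambda>i. 1 / r i {i}"]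
        by (simp add: length_singleton_schedule w_links)
      also have "\<dots> \<le> schedule_length N T"
        unfolding schedule_length_def
        using w T mult_right_mono[of _ 1] by (intro sum_mono) (fastforce simp: is_schedule_def)
      finally show ?thesis .
    qed
    with S show "optimal_schedule N d r ?S"
      by (simp add: optimal_schedule_def)
  qed
qed

end
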